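(* Let $M$ and $M'$ be Markov evolution algebras, and let $G$ and $G'$ be the weighted directed graphs (Markov graphs) associated to $M$ and $M'$, respectively. Then $G'$ is a closed induced subgraph of $G$ if and only if $M'$ generates an evolution subalgebra of the evolution algebra $M$.
   Context: A Markov evolution algebra is a real algebra with a finite basis $\{e_i\mid i\in\Lambda\}$ (its set of generators) and products $e_i\cdot e_j=0$ for $i\ne j$, $e_i^2=\sum_{k\in\Lambda}p_{ik}e_k$, where $0\le p_{ik}\le 1$ and $\sum_{k\in\Lambda}p_{ik}=1$ for all $i\in\Lambda$. Its Markov graph is the weighted directed graph $(V,E)$ with $V=\{e_i\mid i\in\Lambda\}$, $(e_i,e_j)\in E$ if and only if $e_j$ appears in $e_i^2$ (i.e. $p_{ij}\neq 0$), and weight of the edge $(e_i,e_j)$ equal to $p_{ij}$. For a directed graph $(V,E)$, not necessarily weighted, and $V'\subsetneq V$, the subgraph induced by $V'$ has vertex set $V'$ and all edges of $E$ between vertices of $V'$ (with the same weights in the weighted case); it is called closed if $(e_i,e_j)\notin E$ for all $e_i\in V'$ and $e_j\in V\setminus V'$. An evolution subalgebra of $M$ is a subalgebra that is the linear span of a subset of the set of generators of $M$ (not required to be a proper subset). "$M'$ generates an evolution subalgebra of $M$" means: the set of generators $V'$ of $M'$ is a subset of the set of generators of $M$, the span of $V'$ is a subalgebra of $M$, and the product of $M'$ is the restriction of the product of $M$.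
   Formalization: Closed induced subgraphs have a proper vertex set, while evolution subalgebras may be improper, so the claim fails for M' = M; the formal statement therefore reads "G' is a closed induced subgraph of G, or G' = G" on the graph side. *)

theory Defs
  imports Complex_Main "Graph_Theory.Graph_Theory"
begin

text \<open>
  All algebras live in a common ambient real vector space, so that generators of different algebras
  can be compared. The underlying space of an algebra is the span of its generators; the values of
  its multiplication outside that span are irrelevant.
\<close>

record 'v alg_gen =
  gens :: "'v set"
  mult :: "'v \<Rightarrow> 'v \<Rightarrow> 'v"

definition alg_space :: "'v::real_vector alg_gen \<Rightarrow> 'v set" where
  "alg_space M = span (gens M)"

definition real_algebra :: "'v::real_vector alg_gen \<Rightarrow> bool" where
  "real_algebra M \<longleftrightarrow>
     (\<forall>x\<in>alg_space M. \<forall>y\<in>alg_space M. mult M x y \<in> alg_space M) \<and>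
     (\<forall>x\<in>alg_space M. \<forall>y\<in>alg_space M. \<forall>z\<in>alg_space M.
        mult M (x + y) z = mult M x z + mult M y z \<and>
        mult M z (x + y) = mult M z x + mult M z y) \<and>
     (\<forall>c. \<forall>x\<in>alg_space M. \<forall>y\<in>alg_space M.
        mult M (c *\<^sub>R x) y = c *\<^sub>R mult M x y \<and>
        mult M x (c *\<^sub>R y) = c *\<^sub>R mult M x y)"

text \<open>The coefficient $p_{ik}$ of the generator $e_k$ in $e_i^2$, for $e_i = e$ and $e_k = f$.\<close>

definition trans_coeff :: "'v::real_vector alg_gen \<Rightarrow> 'v \<Rightarrow> 'v \<Rightarrow> real" where
  "trans_coeff M e f = representation (gens M) (mult M e e) f"

definition markov_evolution_algebra :: "'v::real_vector alg_gen \<Rightarrow> bool" where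
  "markov_evolution_algebra M \<longleftrightarrow>
     finite (gens M) \<and> independent (gens M) \<and> real_algebra M \<and>
     (\<forall>e\<in>gens M. \<forall>f\<in>gens M. e \<noteq> f \<longrightarrow> mult M e f = 0) \<and>
     (\<forall>e\<in>gens M.
        mult M e e = (\<Sum>f\<in>gens M. trans_coeff M e f *\<^sub>R f) \<and>
        (\<forall>f\<in>gens M. 0 \<le> trans_coeff M e f \<and> trans_coeff M e f \<le> 1) \<and>
        (\<Sum>f\<in>gens M. trans_coeff M e f) = 1)"

definition subalgebra :: "'v::real_vector set \<Rightarrow> 'v alg_gen \<Rightarrow> bool" where
  "subalgebra A M \<longleftrightarrow>
     subspace A \<and> A \<subseteq> alg_space M \<and> (\<forall>x\<in>A. \<forall>y\<in>A. mult M x y \<in> A)"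

definition evolution_subalgebra :: "'v::real_vector set \<Rightarrow> 'v alg_gen \<Rightarrow> bool" where
  "evolution_subalgebra A M \<longleftrightarrow> subalgebra A M \<and> (\<exists>S\<subseteq>gens M. A = span S)"

definition generates_evolution_subalgebra ::
    "'v::real_vector alg_gen \<Rightarrow> 'v alg_gen \<Rightarrow> bool" where
  "generates_evolution_subalgebra M' M \<longleftrightarrow>
     gens M' \<subseteq> gens M \<and>
     evolution_subalgebra (alg_space M') M \<and>
     (\<forall>x\<in>alg_space M'. \<forall>y\<in>alg_space M'. mult M' x y = mult M x y)"

text \<open>Only the weights of arcs are meaningful.\<close>

type_synonym 'a weighted_digraph = "'a pair_pre_digraph \<times> ('a \<times> 'a) weight_fun"

text \<open>
  Pairs that are not arcs get weight 0, so equality of Markov graphs as pairs is equality of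
  weighted digraphs.
\<close>

definition markov_graph :: "'v::real_vector alg_gen \<Rightarrow> 'v weighted_digraph" where
  "markov_graph M =
     (\<lparr>pverts = gens M,
       parcs = {(e, f). e \<in> gens M \<and> f \<in> gens M \<and> trans_coeff M e f \<noteq> 0}\<rparr>,
      \<lambda>(e, f). if e \<in> gens M \<and> f \<in> gens M then trans_coeff M e f else 0)"

definition weighted_induced_subgraph ::
    "'a weighted_digraph \<Rightarrow> 'a weighted_digraph \<Rightarrow> bool" where
  "weighted_induced_subgraph H G \<longleftrightarrow>
     induced_subgraph (with_proj (fst H)) (with_proj (fst G)) \<and>
     (\<forall>a\<in>parcs (fst H). snd H a = snd G a)"

text \<open>
  The vertex set of a closed induced subgraph is required to be proper, whereas
  \<open>induced_subgraph\<close> also admits the full vertex set.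
\<close>

definition closed_induced_subgraph ::
    "'a weighted_digraph \<Rightarrow> 'a weighted_digraph \<Rightarrow> bool" where
  "closed_induced_subgraph H G \<longleftrightarrow>
     pverts (fst H) \<subset> pverts (fst G) \<and>
     weighted_induced_subgraph H G \<and>
     (\<forall>u\<in>pverts (fst H). \<forall>v\<in>pverts (fst G) - pverts (fst H). (u, v) \<notin> parcs (fst G))"

end

theory Submission
  imports Defs
begin

text \<open>
  Both sides of the equivalence say the same thing about coefficients: every generator of \<open>M'\<close> is
  one of \<open>M\<close>, and it has the same row of transition coefficients in \<open>M'\<close> as in \<open>M\<close>. Rows are
  functions on the whole ambient space that vanish off the generators of their own algebra, so
  equality of two rows also contains the vanishing of the coefficients of \<open>M\<close> that lead from a
  generator of \<open>M'\<close> to a generator outside \<open>M'\<close>.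

  On the graph side (\<open>graph_inclusion_iff_same_rows\<close>), closedness is this vanishing, while being
  induced with the same weights is the agreement of the coefficients inside \<open>M'\<close>. On the
  algebra side (\<open>generates_iff_same_rows\<close>), a row determines the square of its generator; all
  products of distinct generators are 0, so by bilinearity the rows determine the product.
  Conversely, a square that lies in the span of fewer generators has the same coordinates with
  respect to the smaller and the larger independent set.
\<close>

definition same_rows :: "'v::real_vector alg_gen \<Rightarrow> 'v alg_gen \<Rightarrow> bool" where
  "same_rows M' M \<longleftrightarrow>
     gens M' \<subseteq> gens M \<and> (\<forall>e\<in>gens M'. trans_coeff M' e = trans_coeff M e)"

lemma trans_coeff_outside: "f \<notin> gens M \<Longrightarrow> trans_coeff M e f = 0"
  unfolding trans_coeff_def using representation_ne_zero by blast

lemma real_algebra_zero: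
  assumes "real_algebra M" "x \<in> alg_space M"
  shows "mult M 0 x = 0" "mult M x 0 = 0"
proof -
  have "mult M (0 *\<^sub>R x) x = 0 *\<^sub>R mult M x x" "mult M x (0 *\<^sub>R x) = 0 *\<^sub>R mult M x x"
    using assms unfolding real_algebra_def by blast+
  then show "mult M 0 x = 0" "mult M x 0 = 0"
    by simp_all
qed

text \<open>
  When one argument is fixed, the vectors on which two bilinear products agree form a subspace, so
  agreement spreads from generators to the span, one argument at a time.
\<close>

lemma mult_eq_if_eq_on_gens:
  assumes A: "real_algebra A" and B: "real_algebra B"
    and sub: "alg_space A \<subseteq> alg_space B"
    and eq: "\<And>e f. e \<in> gens A \<Longrightarrow> f \<in> gens A \<Longrightarrow> mult A e f = mult B e f"
    and x: "x \<in> alg_space A" and y: "y \<in> alg_space A"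
  shows "mult A x y = mult B x y"
proof -
  have gen_in: "e \<in> alg_space A" if "e \<in> gens A" for e
    using that by (simp add: alg_space_def span_base)
  have closed: "0 \<in> alg_space A" "u \<in> alg_space A \<Longrightarrow> v \<in> alg_space A \<Longrightarrow> u + v \<in> alg_space A"
    "u \<in> alg_space A \<Longrightarrow> c *\<^sub>R u \<in> alg_space A" for u v c
    by (auto simp: alg_space_def span_zero span_add span_scale)
  have left: "mult A u e = mult B u e" if e: "e \<in> gens A" and u: "u \<in> alg_space A" for u e
  proof -
    let ?S = "{u \<in> alg_space A. mult A u e = mult B u e}"
    have "e \<in> alg_space A" "e \<in> alg_space B"
      using e sub gen_in by blast+
    then have "subspace ?S"
      using A B sub closed real_algebra_zero[OF A] real_algebra_zero[OF B]
      unfolding subspace_def real_algebra_def by (simp add: subset_iff)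
    moreover have "gens A \<subseteq> ?S"
      using e eq gen_in by blast
    ultimately have "span (gens A) \<subseteq> ?S"
      by (rule span_minimal[rotated])
    then show ?thesis
      using u unfolding alg_space_def by blast
  qed
  let ?S = "{v \<in> alg_space A. mult A x v = mult B x v}"
  have "x \<in> alg_space B"
    using x sub by blast
  then have "subspace ?S"
    using x A B sub closed real_algebra_zero[OF A] real_algebra_zero[OF B]
    unfolding subspace_def real_algebra_def by (simp add: subset_iff)
  moreover have "gens A \<subseteq> ?S"
    using x left gen_in by blast
  ultimately have "span (gens A) \<subseteq> ?S"
    by (rule span_minimal[rotated])
  then show ?thesis
    using y unfolding alg_space_def by blast
qed

lemma generates_iff_same_rows:
  fixes M M' :: "'v::real_vector alg_gen"
  assumes M: "markov_evolution_algebra M" and M': "markov_evolution_algebra M'"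
  shows "generates_evolution_subalgebra M' M \<longleftrightarrow> same_rows M' M"
proof
  assume gen: "generates_evolution_subalgebra M' M"
  then have sub: "gens M' \<subseteq> gens M"
    by (simp add: generates_evolution_subalgebra_def)
  have "trans_coeff M' e = trans_coeff M e" if e: "e \<in> gens M'" for e
  proof -
    have e_in: "e \<in> alg_space M'"
      using e by (simp add: alg_space_def span_base)
    then have sq: "mult M' e e = mult M e e"
      using gen by (simp add: generates_evolution_subalgebra_def)
    have "mult M' e e \<in> span (gens M')"
      using M' e_in by (simp add: markov_evolution_algebra_def real_algebra_def alg_space_def)
    then have "representation (gens M) (mult M' e e) = representation (gens M') (mult M' e e)"
      using M sub by (intro representation_extend) (auto simp: markov_evolution_algebra_def)
    then show ?thesis
      by (simp add: trans_coeff_def sq fun_eq_iff)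
  qed
  with sub show "same_rows M' M"
    by (simp add: same_rows_def)
next
  assume rows: "same_rows M' M"
  then have sub: "gens M' \<subseteq> gens M"
    by (simp add: same_rows_def)
  then have space: "alg_space M' \<subseteq> alg_space M"
    by (simp add: alg_space_def span_mono)
  have fin: "finite (gens M)"
    using M by (simp add: markov_evolution_algebra_def)
  have on_gens: "mult M' e f = mult M e f" if e: "e \<in> gens M'" and f: "f \<in> gens M'" for e f
  proof (cases "e = f")
    case True
    have "mult M' e e = (\<Sum>g\<in>gens M'. trans_coeff M' e g *\<^sub>R g)"
      using M' e unfolding markov_evolution_algebra_def by blast
    also have "\<dots> = (\<Sum>g\<in>gens M. trans_coeff M' e g *\<^sub>R g)"
      using fin sub by (intro sum.mono_neutral_left) (auto simp: trans_coeff_outside)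
    also have "\<dots> = (\<Sum>g\<in>gens M. trans_coeff M e g *\<^sub>R g)"
      using rows e by (simp add: same_rows_def)
    also have "\<dots> = mult M e e"
      using M e sub unfolding markov_evolution_algebra_def by (metis subsetD)
    finally show ?thesis
      using True by simp
  next
    case False
    then show ?thesis
      using M M' e f sub unfolding markov_evolution_algebra_def by (metis subsetD)
  qed
  have alg: "real_algebra M'" "real_algebra M"
    using M M' by (simp_all add: markov_evolution_algebra_def)
  have restr: "mult M' x y = mult M x y" if "x \<in> alg_space M'" "y \<in> alg_space M'" for x y
    using mult_eq_if_eq_on_gens[OF alg space on_gens that] .
  \<comment> \<open>The span of the generators of \<open>M'\<close> is closed under the product of \<open>M\<close> because it is closed
    under that of \<open>M'\<close>, which is now known to be the same.\<close>
  then have "subalgebra (alg_space M') M"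
    using alg(1) space unfolding subalgebra_def real_algebra_def
    by (metis alg_space_def subspace_span)
  with sub restr show "generates_evolution_subalgebra M' M"
    unfolding generates_evolution_subalgebra_def evolution_subalgebra_def
    by (auto simp: alg_space_def)
qed

lemma weighted_induced_subgraph_markov_graph_iff:
  "weighted_induced_subgraph (markov_graph M') (markov_graph M) \<longleftrightarrow>
     gens M' \<subseteq> gens M \<and>
     (\<forall>e\<in>gens M'. \<forall>f\<in>gens M'. trans_coeff M' e f = trans_coeff M e f)"
  (is "?L \<longleftrightarrow> ?R")
proof
  assume L: ?L
  then have sub: "gens M' \<subseteq> gens M"
    and arcs: "{(e, f). e \<in> gens M' \<and> f \<in> gens M' \<and> trans_coeff M' e f \<noteq> 0} =
      {a \<in> {(e, f). e \<in> gens M \<and> f \<in> gens M \<and> trans_coeff M e f \<noteq> 0}.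
        fst a \<in> gens M' \<and> snd a \<in> gens M'}"
    by (simp_all add: weighted_induced_subgraph_def induced_subgraph_def subgraph_def
        markov_graph_def)
  have weights: "trans_coeff M' e f = trans_coeff M e f"
    if "e \<in> gens M'" "f \<in> gens M'" "trans_coeff M' e f \<noteq> 0" for e f
  proof -
    have "snd (markov_graph M') (e, f) = snd (markov_graph M) (e, f)"
      using L that by (simp add: weighted_induced_subgraph_def markov_graph_def)
    then show ?thesis
      using that sub by (auto simp: markov_graph_def)
  qed
  \<comment> \<open>On arcs the weights agree; on the other pairs both coefficients are 0, because an induced
    subgraph omits no arc between its vertices.\<close>
  have "trans_coeff M' e f = trans_coeff M e f" if "e \<in> gens M'" "f \<in> gens M'" for e f
  proof (cases "trans_coeff M' e f = 0")
    case True
    have "(e, f) \<notin> {(e, f). e \<in> gens M' \<and> f \<in> gens M' \<and> trans_coeff M' e f \<noteq> 0}"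
      using True by simp
    then show ?thesis
      unfolding arcs using True that sub by auto
  qed (use weights that in blast)
  with sub show ?R
    by blast
next
  assume R: ?R
  have "wf_digraph (with_proj (fst (markov_graph N)))" for N :: "'a alg_gen"
    by unfold_locales (auto simp: markov_graph_def)
  with R show ?L
    by (auto simp: weighted_induced_subgraph_def induced_subgraph_def subgraph_def
        compatible_def markov_graph_def)
qed

lemma markov_graph_eq_iff_same_rows:
  "markov_graph M' = markov_graph M \<longleftrightarrow> gens M' = gens M \<and> same_rows M' M"
proof
  assume eq: "markov_graph M' = markov_graph M"
  then have gens: "gens M' = gens M"
    by (simp add: markov_graph_def)
  have "trans_coeff M' e f = trans_coeff M e f" if e: "e \<in> gens M'" for e f
  proof (cases "f \<in> gens M'")
    case True
    have "snd (markov_graph M') (e, f) = snd (markov_graph M) (e, f)"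
      using eq by simp
    then show ?thesis
      using e True gens by (simp add: markov_graph_def)
  qed (simp add: gens trans_coeff_outside)
  with gens show "gens M' = gens M \<and> same_rows M' M"
    by (auto simp: same_rows_def)
next
  assume "gens M' = gens M \<and> same_rows M' M"
  then show "markov_graph M' = markov_graph M"
    by (auto simp: same_rows_def markov_graph_def fun_eq_iff)
qed

lemma closed_induced_subgraph_markov_graph_iff_same_rows:
  "closed_induced_subgraph (markov_graph M') (markov_graph M) \<longleftrightarrow>
     gens M' \<subset> gens M \<and> same_rows M' M"
proof
  assume closed: "closed_induced_subgraph (markov_graph M') (markov_graph M)"
  then have proper: "gens M' \<subset> gens M"
    and inside: "\<And>e f. e \<in> gens M' \<Longrightarrow> f \<in> gens M' \<Longrightarrow> trans_coeff M' e f = trans_coeff M e f"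
    and leaving: "\<And>e f. e \<in> gens M' \<Longrightarrow> f \<in> gens M - gens M' \<Longrightarrow> trans_coeff M e f = 0"
    by (auto simp: closed_induced_subgraph_def weighted_induced_subgraph_markov_graph_iff)
      (auto simp: markov_graph_def)
  have "trans_coeff M' e f = trans_coeff M e f" if "e \<in> gens M'" for e f
    using that inside leaving trans_coeff_outside by (metis DiffI)
  with proper show "gens M' \<subset> gens M \<and> same_rows M' M"
    by (auto simp: same_rows_def)
next
  assume rows: "gens M' \<subset> gens M \<and> same_rows M' M"
  have "trans_coeff M e f = 0" if "e \<in> gens M'" "f \<notin> gens M'" for e f
    using rows that trans_coeff_outside unfolding same_rows_def by metis
  with rows show "closed_induced_subgraph (markov_graph M') (markov_graph M)"
    unfolding closed_induced_subgraph_def weighted_induced_subgraph_markov_graph_iff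
    by (auto simp: same_rows_def markov_graph_def)
qed

text \<open>
  Closed induced subgraphs have a proper vertex set; equality of the Markov graphs supplies the
  case in which both algebras have the same generators.
\<close>

lemma graph_inclusion_iff_same_rows:
  "closed_induced_subgraph (markov_graph M') (markov_graph M) \<or> markov_graph M' = markov_graph M
     \<longleftrightarrow> same_rows M' M"
  unfolding closed_induced_subgraph_markov_graph_iff_same_rows markov_graph_eq_iff_same_rows
  by (auto simp: same_rows_def)

theorem theorem2p21:
  fixes M M' :: "'v::real_vector alg_gen"
  assumes "markov_evolution_algebra M"
    and "markov_evolution_algebra M'"
  shows "closed_induced_subgraph (markov_graph M') (markov_graph M) \<or>
         markov_graph M' = markov_graph M
     \<longleftrightarrow> generates_evolution_subalgebra M' M"
  using assms by (simp add: graph_inclusion_iff_same_rows generates_iff_same_rows)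

end
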